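(* Let $M$ be a smooth closed $m$-dimensional submanifold of the affine space $\mathbb R^n$, with $n\le 2m$. Then the global centre symmetry set $GCS(M)$ contains the Wigner caustic $E_{1/2}(M)$ of $M$.
   Context: "Closed" means compact without boundary. A pair $a,b\in M$, $a\ne b$, is weakly parallel if $T_aM+\tau_{a-b}(T_bM)\ne T_a\mathbb R^n$, where $\tau_{a-b}$ is the translation $x\mapsto x+(a-b)$. For $\lambda\in\mathbb R$, the affine $\lambda$-equidistant $E_\lambda(M)$ is the set of all $x=\lambda a+(1-\lambda)b$ with $a,b$ a weakly parallel pair of $M$. $E_{1/2}(M)$ is called the Wigner caustic of $M$. The affine extended wave front is $\mathbb E(M)=\bigcup_{\lambda\in\mathbb R}\{\lambda\}\times E_\lambda(M)\subset\mathbb R\times\mathbb R^n$. Let $\pi:\mathbb R\times\mathbb R^n\to\mathbb R^n$, $\pi(\lambda,x)=x$, and $\pi_r=\pi|_{\mathbb E(M)}$. A point of $\mathbb E(M)$ is a critical point of $\pi_r$ if the germ of $\pi_r$ there fails to be the germ of a regular projection of a smooth submanifold. That is, either $\mathbb E(M)$ is not a smooth submanifold near the point (the point is not regular), or it is, but the fibre of $\pi$ through the point is tangent to $\mathbb E(M)$ there. $GCS(M)$ is the image under $\pi$ of the set of critical points of $\pi_r$. *)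

theory Defs
  imports "HOL-Analysis.Analysis"
begin

text \<open>
  \<open>Ck_on k S f\<close> says that \<open>f\<close> is of class C^k; it is intended for open \<open>S\<close>.
  The derivative is required along every fixed direction \<open>v\<close>, so that the
  type of the function does not change in the recursion.
\<close>

primrec Ck_on ::
  "nat \<Rightarrow> 'a::euclidean_space set \<Rightarrow> ('a \<Rightarrow> 'b::euclidean_space) \<Rightarrow> bool" where
  "Ck_on 0 S f \<longleftrightarrow> continuous_on S f"
| "Ck_on (Suc k) S f \<longleftrightarrow>
     (\<forall>x\<in>S. f differentiable (at x)) \<and>
     (\<forall>v. Ck_on k S (\<lambda>x. frechet_derivative f (at x) v))"

definition smooth_on ::
  "'a::euclidean_space set \<Rightarrow> ('a \<Rightarrow> 'b::euclidean_space) \<Rightarrow> bool" where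
  "smooth_on S f \<longleftrightarrow> (\<forall>k. Ck_on k S f)"

text \<open>
  Embedded submanifolds without boundary, by charts of the ambient space that
  flatten \<open>S\<close> to a \<open>d\<close>-dimensional linear subspace \<open>L\<close>.
\<close>

definition smooth_submanifold :: "nat \<Rightarrow> 'a::euclidean_space set \<Rightarrow> bool" where
  "smooth_submanifold d S \<longleftrightarrow>
     (\<forall>p\<in>S. \<exists>U (V :: 'a set) f g L.
        open U \<and> open V \<and> p \<in> U \<and>
        homeomorphism U V f g \<and> smooth_on U f \<and> smooth_on V g \<and>
        subspace L \<and> dim L = d \<and> f ` (S \<inter> U) = V \<inter> L)"

definition tangent_space :: "'a::euclidean_space set \<Rightarrow> 'a \<Rightarrow> 'a set" where
  "tangent_space S p =
     {v. \<exists>e>0. \<exists>\<gamma>::real \<Rightarrow> 'a.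
        smooth_on {-e<..<e} \<gamma> \<and> \<gamma> ` {-e<..<e} \<subseteq> S \<and> \<gamma> 0 = p \<and>
        (\<gamma> has_vector_derivative v) (at 0)}"

text \<open>
  Tangent vectors at any point are elements of the ambient vector space, so the
  translation by \<open>a - b\<close>, which carries vectors at \<open>b\<close> to vectors at \<open>a\<close>, is the
  identity on them, and the tangent space of the ambient space at \<open>a\<close> is \<open>UNIV\<close>.
\<close>

definition weakly_parallel :: "'a::euclidean_space set \<Rightarrow> 'a \<Rightarrow> 'a \<Rightarrow> bool" where
  "weakly_parallel M a b \<longleftrightarrow>
     a \<in> M \<and> b \<in> M \<and> a \<noteq> b \<and>
     {u + v |u v. u \<in> tangent_space M a \<and> v \<in> tangent_space M b} \<noteq> UNIV"

definition equidistant :: "real \<Rightarrow> 'a::euclidean_space set \<Rightarrow> 'a set" where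
  "equidistant l M = {l *\<^sub>R a + (1 - l) *\<^sub>R b |a b. weakly_parallel M a b}"

definition Wigner_caustic :: "'a::euclidean_space set \<Rightarrow> 'a set" where
  "Wigner_caustic M = equidistant (1/2) M"

definition extended_wave_front :: "'a::euclidean_space set \<Rightarrow> (real \<times> 'a) set" where
  "extended_wave_front M = (\<Union>l. {l} \<times> equidistant l M)"

text \<open>The dimension \<open>d\<close> of the submanifold germ is not prescribed.\<close>

definition regular_point :: "'a::euclidean_space set \<Rightarrow> 'a \<Rightarrow> bool" where
  "regular_point S p \<longleftrightarrow> p \<in> S \<and> (\<exists>U d. open U \<and> p \<in> U \<and> smooth_submanifold d (S \<inter> U))"

text \<open>
  Critical points of the restriction to \<open>E\<close> of the projection \<open>snd\<close>. The fibre
  of \<open>snd\<close> is a line, so it is tangent to \<open>E\<close> iff its tangent space is contained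
  in that of \<open>E\<close>.
\<close>

definition critical_point :: "(real \<times> 'a::euclidean_space) set \<Rightarrow> real \<times> 'a \<Rightarrow> bool" where
  "critical_point E p \<longleftrightarrow>
     p \<in> E \<and>
     (\<not> regular_point E p \<or>
      tangent_space (snd -` {snd p}) p \<subseteq> tangent_space E p)"

definition GCS :: "'a::euclidean_space set \<Rightarrow> 'a set" where
  "GCS M = snd ` {p. critical_point (extended_wave_front M) p}"

end

theory Submission imports Defs begin

text \<open>
  Let \<open>x = (a + b)/2\<close> with \<open>a, b\<close> weakly parallel, and let \<open>E\<close> be the affine
  extended wave front.  The point \<open>(1/2, x)\<close> of \<open>E\<close> is critical because weak
  parallelism is symmetric: \<open>E\<close> contains both lines
  \<open>t \<mapsto> (t, t a + (1 - t) b)\<close> and \<open>t \<mapsto> (t, t b + (1 - t) a)\<close>, and these cross at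
  \<open>(1/2, x)\<close> with velocities \<open>(1, a - b)\<close> and \<open>(1, b - a)\<close>.  If \<open>E\<close> fails to be a
  submanifold there, the point is critical by definition.  Otherwise the tangent
  space is linear, so it contains \<open>(1, a - b) + (1, b - a) = (2, 0)\<close> and with it the
  whole direction of the fibre of the projection.

  The tangent space is defined by velocities of curves, for which closure under
  addition is not automatic.  It comes from a chart: \<open>tangent_space_chart\<close> identifies
  the tangent space with the image of the model subspace under the derivative of the
  inverse chart.
\<close>

section \<open>Smooth curves\<close>

text \<open>
  The recursion for \<open>Ck_on\<close> replaces a function by its derivative, which is known
  only at the points of \<open>S\<close>; hence the need to change functions off \<open>S\<close>.
\<close>

lemma Ck_on_cong:
  assumes "open S" and "\<And>x. x \<in> S \<Longrightarrow> f x = g x" and "Ck_on k S f"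
  shows "Ck_on k S g"
  using assms(2,3)
proof (induction k arbitrary: f g)
  case 0
  then show ?case
    using continuous_on_cong[of S S f g] by simp
next
  case (Suc k)
  have deriv: "(g has_derivative frechet_derivative f (at x)) (at x)" if "x \<in> S" for x
    using has_derivative_transform_within_open[OF _ \<open>open S\<close> that Suc.prems(1)]
      Suc.prems(2) that by (simp add: frechet_derivative_works)
  have "Ck_on k S (\<lambda>x. frechet_derivative g (at x) v)" for v
  proof (rule Suc.IH)
    show "frechet_derivative f (at x) v = frechet_derivative g (at x) v" if "x \<in> S" for x
      using frechet_derivative_at[OF deriv[OF that]] by simp
    show "Ck_on k S (\<lambda>x. frechet_derivative f (at x) v)"
      using Suc.prems(2) by simp
  qed
  then show ?case
    using deriv by (auto simp: differentiable_def)
qed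

text \<open>
  For an affine inner curve the chain rule reproduces its own shape: the derivative of
  \<open>t \<mapsto> g (q + t w)\<close> is the directional derivative of \<open>g\<close> composed with the same curve.
  No product rule enters, and the induction on \<open>k\<close> closes.
\<close>

lemma Ck_on_compose_line:
  fixes g :: "'a::euclidean_space \<Rightarrow> 'b::euclidean_space"
  assumes "open I" and "\<And>t. t \<in> I \<Longrightarrow> q + t *\<^sub>R w \<in> V" and "Ck_on k V g"
  shows "Ck_on k I (\<lambda>t::real. g (q + t *\<^sub>R w))"
  using assms(3)
proof (induction k arbitrary: g)
  case 0
  then have "continuous_on V g" by simp
  then show ?case
    using assms(2)
    by (auto intro!: continuous_on_compose2[of V g] continuous_intros)
next
  case (Suc k)
  have deriv: "((\<lambda>t. g (q + t *\<^sub>R w)) has_derivative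
      (\<lambda>s. frechet_derivative g (at (q + t *\<^sub>R w)) (s *\<^sub>R w))) (at t)" if "t \<in> I" for t
  proof -
    have "(g has_derivative frechet_derivative g (at (q + t *\<^sub>R w))) (at (q + t *\<^sub>R w))"
      using Suc.prems assms(2)[OF that] by (simp add: frechet_derivative_works)
    then show ?thesis
      by (rule has_derivative_compose[rotated]) (auto intro!: derivative_eq_intros)
  qed
  have "Ck_on k I (\<lambda>t. frechet_derivative (\<lambda>t. g (q + t *\<^sub>R w)) (at t) s)" for s
  proof (rule Ck_on_cong[OF \<open>open I\<close>])
    show "frechet_derivative g (at (q + t *\<^sub>R w)) (s *\<^sub>R w)
        = frechet_derivative (\<lambda>t. g (q + t *\<^sub>R w)) (at t) s" if "t \<in> I" for t
      using frechet_derivative_at[OF deriv[OF that]] by metis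
    show "Ck_on k I (\<lambda>t. frechet_derivative g (at (q + t *\<^sub>R w)) (s *\<^sub>R w))"
      using Suc.prems by (intro Suc.IH) simp
  qed
  then show ?case
    using deriv by (auto simp: differentiable_def)
qed

lemma smooth_on_compose_line:
  fixes g :: "'a::euclidean_space \<Rightarrow> 'b::euclidean_space"
  assumes "open I" and "\<And>t. t \<in> I \<Longrightarrow> q + t *\<^sub>R w \<in> V" and "smooth_on V g"
  shows "smooth_on I (\<lambda>t::real. g (q + t *\<^sub>R w))"
  using assms Ck_on_compose_line unfolding smooth_on_def by metis

lemma Ck_on_const: "Ck_on k S (\<lambda>x. c)"
  by (induction k arbitrary: c) auto

lemma smooth_on_ident: "smooth_on S (\<lambda>x. x)"
proof -
  have "Ck_on k S (\<lambda>x. x)" for k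
    by (cases k) (auto simp: Ck_on_const intro: continuous_on_id)
  then show ?thesis
    by (simp add: smooth_on_def)
qed

section \<open>Tangent spaces\<close>

text \<open>The difference quotients lie in \<open>L\<close>, and finite-dimensional subspaces are closed.\<close>

lemma velocity_in_subspace:
  fixes \<gamma> :: "real \<Rightarrow> 'a::euclidean_space"
  assumes "subspace L" and "(\<gamma> has_vector_derivative v) (at 0)"
    and "eventually (\<lambda>t. \<gamma> t - \<gamma> 0 \<in> L) (at 0)"
  shows "v \<in> L"
proof -
  have "((\<lambda>t. norm (\<gamma> t - \<gamma> 0 - t *\<^sub>R v) / norm t) \<longlongrightarrow> 0) (at 0)"
    using assms(2) by (simp add: has_vector_derivative_def has_derivative_iff_norm)
  moreover have "eventually (\<lambda>t. norm (\<gamma> t - \<gamma> 0 - t *\<^sub>R v) / norm t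
      = norm ((\<gamma> t - \<gamma> 0) /\<^sub>R t - v)) (at 0)"
  proof -
    have "norm (\<gamma> t - \<gamma> 0 - t *\<^sub>R v) / norm t = norm ((\<gamma> t - \<gamma> 0) /\<^sub>R t - v)"
      if "t \<noteq> 0" for t
    proof -
      have "(\<gamma> t - \<gamma> 0) /\<^sub>R t - v = (\<gamma> t - \<gamma> 0 - t *\<^sub>R v) /\<^sub>R t"
        using that by (simp add: scaleR_diff_right)
      then show ?thesis
        by (simp add: divide_inverse mult.commute)
    qed
    then show ?thesis
      by (auto simp: eventually_at_filter)
  qed
  ultimately have "((\<lambda>t. norm ((\<gamma> t - \<gamma> 0) /\<^sub>R t - v)) \<longlongrightarrow> 0) (at 0)"
    by (rule Lim_transform_eventually)
  then have "((\<lambda>t. (\<gamma> t - \<gamma> 0) /\<^sub>R t) \<longlongrightarrow> v) (at 0)"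
    by (rule LIM_zero_cancel[OF tendsto_norm_zero_cancel])
  moreover have "eventually (\<lambda>t. (\<gamma> t - \<gamma> 0) /\<^sub>R t \<in> L) (at 0)"
    using assms(3) by eventually_elim (simp add: assms(1) subspace_scale)
  ultimately show ?thesis
    using Lim_in_closed_set[OF closed_subspace[OF assms(1)]] by (metis trivial_limit_at)
qed

lemma line_velocity_in_tangent_space:
  fixes p w :: "'a::euclidean_space"
  assumes "\<And>t::real. p + t *\<^sub>R w \<in> S"
  shows "w \<in> tangent_space S p"
proof -
  have "smooth_on {-1<..<1} (\<lambda>t::real. p + t *\<^sub>R w)"
    by (rule smooth_on_compose_line[of _ _ _ UNIV]) (auto simp: smooth_on_ident)
  moreover have "((\<lambda>t. p + t *\<^sub>R w) has_vector_derivative w) (at 0)"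
    by (auto intro!: derivative_eq_intros)
  ultimately show ?thesis
    unfolding tangent_space_def using assms
    by (intro CollectI exI[of _ 1] exI[of _ "\<lambda>t. p + t *\<^sub>R w"]) auto
qed

text \<open>
  A curve in \<open>S\<close> is carried by the chart \<open>f\<close> to a curve in \<open>L\<close>, whose velocity lies in
  \<open>L\<close>; conversely \<open>g\<close> carries a short segment in \<open>L\<close> to a curve in \<open>S\<close>.  The chart is
  taken for \<open>S \<inter> W\<close>, as in \<open>regular_point\<close>, and the tangent space for \<open>S\<close>: curves
  through \<open>p\<close> stay in the open set \<open>W\<close> for a short time.
\<close>

lemma tangent_space_chart:
  fixes S :: "'a::euclidean_space set"
  assumes "p \<in> S" "open W" "p \<in> W" "open U" "open V" "p \<in> U"
    and hom: "homeomorphism U V f g" and "smooth_on U f" "smooth_on V g"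
    and "subspace L" and img: "f ` (S \<inter> W \<inter> U) = V \<inter> L"
  shows "linear (frechet_derivative g (at (f p)))"
    and "tangent_space S p = frechet_derivative g (at (f p)) ` L"
proof -
  define Df where "Df = frechet_derivative f (at p)"
  define Dg where "Dg = frechet_derivative g (at (f p))"
  have gf: "g (f x) = x" if "x \<in> U" for x
    using hom that by (simp add: homeomorphism_def)
  have fp: "f p \<in> V \<inter> L"
    using img assms(1,3,6) by blast
  have "Ck_on 1 U f" "Ck_on 1 V g"
    using assms(8,9) by (auto simp only: smooth_on_def)
  then have Df: "(f has_derivative Df) (at p)" and Dg: "(g has_derivative Dg) (at (f p))"
    using \<open>p \<in> U\<close> fp by (auto simp: Df_def Dg_def frechet_derivative_works)
  show "linear (frechet_derivative g (at (f p)))"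
    using Dg unfolding Dg_def by (rule has_derivative_linear)
  have "((\<lambda>x. g (f x)) has_derivative (\<lambda>v. Dg (Df v))) (at p)"
    using Df Dg by (rule has_derivative_compose)
  then have "((\<lambda>x. x) has_derivative (\<lambda>v. Dg (Df v))) (at p)"
    by (rule has_derivative_transform_within_open[OF _ \<open>open U\<close> \<open>p \<in> U\<close> gf])
  then have DgDf: "Dg (Df v) = v" for v
    using has_derivative_unique[OF _ has_derivative_ident] by metis
  have "v \<in> Dg ` L" if v: "v \<in> tangent_space S p" for v
  proof -
    obtain e \<gamma> where "e > 0" and \<gamma>S: "\<gamma> ` {-e<..<e} \<subseteq> S" and "\<gamma> 0 = p"
      and \<gamma>v: "(\<gamma> has_vector_derivative v) (at 0)"
      using v unfolding tangent_space_def by blast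
    have "isCont \<gamma> 0"
      using \<gamma>v has_vector_derivative_continuous by blast
    then have "eventually (\<lambda>t. \<gamma> t \<in> W \<inter> U) (at 0)"
      using assms(2-4,6) \<open>\<gamma> 0 = p\<close> topological_tendstoD[of \<gamma> p "at 0" "W \<inter> U"]
      by (auto simp: isCont_def)
    moreover have "eventually (\<lambda>t. t \<in> {-e<..<e}) (at 0)"
      using \<open>e > 0\<close> by (intro eventually_at_in_open') auto
    ultimately have "eventually (\<lambda>t. f (\<gamma> t) - f (\<gamma> 0) \<in> L) (at 0)"
    proof eventually_elim
      case (elim t)
      then have "f (\<gamma> t) \<in> V \<inter> L"
        using \<gamma>S img by blast
      then show ?case
        using fp \<open>\<gamma> 0 = p\<close> \<open>subspace L\<close> by (simp add: subspace_diff)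
    qed
    moreover have "((\<lambda>t. f (\<gamma> t)) has_vector_derivative Df v) (at 0)"
      using vector_derivative_diff_chain_within[of \<gamma> v 0 UNIV f Df] \<gamma>v Df \<open>\<gamma> 0 = p\<close>
      by (simp add: o_def has_derivative_at_withinI)
    ultimately have "Df v \<in> L"
      using velocity_in_subspace[OF \<open>subspace L\<close>] by blast
    then show ?thesis
      using DgDf by (metis imageI)
  qed
  moreover have "Dg w \<in> tangent_space S p" if "w \<in> L" for w
  proof -
    let ?l = "\<lambda>t::real. f p + t *\<^sub>R w"
    have "open (?l -` V)"
      using \<open>open V\<close> by (intro open_vimage continuous_intros)
    moreover have "0 \<in> ?l -` V"
      using fp by simp
    ultimately obtain e where "e > 0" and e: "ball 0 e \<subseteq> ?l -` V"
      using open_contains_ball by metis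
    have lV: "?l t \<in> V" if "t \<in> {-e<..<e}" for t
      using e that by (auto simp: subset_iff dist_real_def)
    have "smooth_on {-e<..<e} (\<lambda>t. g (?l t))"
      using lV \<open>smooth_on V g\<close> by (intro smooth_on_compose_line) auto
    moreover have "g (?l t) \<in> S" if "t \<in> {-e<..<e}" for t
    proof -
      have "?l t \<in> V \<inter> L"
        using lV[OF that] fp \<open>w \<in> L\<close> \<open>subspace L\<close> by (simp add: subspace_add subspace_scale)
      then obtain y where "y \<in> S \<inter> W \<inter> U" "?l t = f y"
        using img by blast
      then show ?thesis
        using gf by simp
    qed
    moreover have "((\<lambda>t. g (?l t)) has_vector_derivative Dg w) (at 0)"
    proof -
      have "(?l has_vector_derivative w) (at 0)"
        by (auto intro!: derivative_eq_intros)
      then show ?thesis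
        using vector_derivative_diff_chain_within[of ?l w 0 UNIV g Dg] Dg
        by (simp add: o_def has_derivative_at_withinI)
    qed
    ultimately show ?thesis
      unfolding tangent_space_def using \<open>e > 0\<close> gf[OF \<open>p \<in> U\<close>]
      by (intro CollectI exI[of _ e] conjI exI[of _ "\<lambda>t. g (?l t)"]) auto
  qed
  ultimately show "tangent_space S p = frechet_derivative g (at (f p)) ` L"
    unfolding Dg_def by blast
qed

lemma subspace_tangent_space:
  assumes "regular_point S p"
  shows "subspace (tangent_space S p)"
proof -
  obtain W d where W: "p \<in> S" "open W" "p \<in> W" and "smooth_submanifold d (S \<inter> W)"
    using assms unfolding regular_point_def by blast
  then obtain U f g L and V :: "'a set" where "open U" "open V" "p \<in> U"
      "homeomorphism U V f g" "smooth_on U f" "smooth_on V g" "subspace L"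
      "f ` (S \<inter> W \<inter> U) = V \<inter> L"
    unfolding smooth_submanifold_def by (metis IntI)
  from tangent_space_chart[OF W this] show ?thesis
    using linear_subspace_image[OF _ \<open>subspace L\<close>] by metis
qed

lemma tangent_space_fibre:
  fixes p :: "real \<times> 'a::euclidean_space"
  assumes "v \<in> tangent_space (snd -` {snd p}) p"
  shows "v = (fst v, 0)"
proof -
  obtain e \<gamma> where "e > 0" and \<gamma>: "\<gamma> ` {-e<..<e} \<subseteq> snd -` {snd p}" "\<gamma> 0 = p"
    and \<gamma>v: "(\<gamma> has_vector_derivative v) (at 0)"
    using assms unfolding tangent_space_def by blast
  have "eventually (\<lambda>t. t \<in> {-e<..<e}) (at 0)"
    using \<open>e > 0\<close> by (intro eventually_at_in_open') auto
  then have "eventually (\<lambda>t. \<gamma> t - \<gamma> 0 \<in> {u. snd u = 0}) (at 0)"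
    by eventually_elim (use \<gamma> in \<open>simp add: image_subset_iff\<close>)
  moreover have "subspace {u :: real \<times> 'a. snd u = 0}"
    by (auto simp: subspace_def)
  ultimately have "snd v = 0"
    using velocity_in_subspace \<gamma>v by blast
  then show ?thesis
    by (simp add: prod_eq_iff)
qed

section \<open>The Wigner caustic\<close>

lemma weakly_parallel_sym:
  assumes "weakly_parallel M a b"
  shows "weakly_parallel M b a"
proof -
  have "{u + v |u v. u \<in> A \<and> v \<in> B} = {u + v |u v. u \<in> B \<and> v \<in> A}" for A B :: "'a set"
    using add.commute by blast
  then show ?thesis
    using assms unfolding weakly_parallel_def by auto
qed

lemma extended_wave_front_line_tangent:
  assumes "weakly_parallel M a b"
  shows "(1, a - b) \<in> tangent_space (extended_wave_front M) (1/2, (1/2) *\<^sub>R (a + b))"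
proof (rule line_velocity_in_tangent_space)
  fix t :: real
  let ?l = "1/2 + t"
  have "(1/2, (1/2) *\<^sub>R (a + b)) + t *\<^sub>R (1, a - b) = (?l, ?l *\<^sub>R a + (1 - ?l) *\<^sub>R b)"
    by (simp add: algebra_simps)
  also have "\<dots> \<in> extended_wave_front M"
    using assms unfolding extended_wave_front_def equidistant_def by blast
  finally show "(1/2, (1/2) *\<^sub>R (a + b)) + t *\<^sub>R (1, a - b) \<in> extended_wave_front M" .
qed

theorem theorem2p8:
  fixes M :: "(real ^ 'n) set" and m :: nat
  assumes "smooth_submanifold m M"
    and "compact M"
    and "CARD('n) \<le> 2 * m"
  shows "Wigner_caustic M \<subseteq> GCS M"
proof
  fix x
  assume x: "x \<in> Wigner_caustic M"
  then obtain a b where ab: "weakly_parallel M a b" and x_eq: "x = (1/2) *\<^sub>R (a + b)"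
    unfolding Wigner_caustic_def equidistant_def by (auto simp: scaleR_add_right)
  let ?E = "extended_wave_front M" and ?p = "(1/2 :: real, x)"
  have "?p \<in> ?E"
    using x unfolding extended_wave_front_def Wigner_caustic_def by blast
  moreover have "tangent_space (snd -` {snd ?p}) ?p \<subseteq> tangent_space ?E ?p"
    if "regular_point ?E ?p"
  proof
    fix v
    assume "v \<in> tangent_space (snd -` {snd ?p}) ?p"
    then have "v = (fst v, 0)"
      by (rule tangent_space_fibre)
    \<comment> \<open>The spatial parts of the two line directions cancel, leaving the fibre direction.\<close>
    then have v: "v = (fst v / 2) *\<^sub>R ((1, a - b) + (1, b - a))"
      by (simp add: prod_eq_iff)
    have "(1, a - b) \<in> tangent_space ?E ?p"
      using extended_wave_front_line_tangent[OF ab] x_eq by simp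
    moreover have "(1, b - a) \<in> tangent_space ?E ?p"
      using extended_wave_front_line_tangent[OF weakly_parallel_sym[OF ab]] x_eq
      by (simp add: add.commute)
    ultimately show "v \<in> tangent_space ?E ?p"
      using subspace_tangent_space[OF that] v by (metis subspace_add subspace_scale)
  qed
  ultimately have "critical_point ?E ?p"
    unfolding critical_point_def by blast
  then show "x \<in> GCS M"
    unfolding GCS_def by (metis (mono_tags) image_eqI mem_Collect_eq snd_conv)
qed

end
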